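(* Let $w>0$ and consider a Twizzler $$\phi(s,t)=(x(s)\cos(wt)+z(s)\sin(wt),\ t,\ -x(s)\sin(wt)+z(s)\cos(wt))$$ with constant mean curvature $1$ and with profile curve $\alpha(s)=(x(s),z(s))$, $s\in\mathbb{R}$, parametrized by arc length. Then there is some $M\ge -\frac14$ such that the TreadmillSled of $\alpha$ is (has as its image) the heart-shaped curve $$-h_w^{-1}(M)=\{-(x_1,x_2): h_w(x_1,x_2)=M\},\qquad h_w(x_1,x_2)=x_1^2+x_2^2+\frac{x_2}{\sqrt{1+w^2x_1^2}}.$$ The value $M=-\frac14$ is achieved by a cylinder of radius $\frac12$.
   Context: A Twizzler is an immersion of the form $\phi(s,t)=(x(s)\cos(wt)+z(s)\sin(wt),\,t,\,-x(s)\sin(wt)+z(s)\cos(wt))$ with constant mean curvature; the curve $(x(s),z(s))$, parametrized by arc length, is its profile curve. The mean curvature is half the sum of the principal curvatures, computed with respect to the Gauss map $\nu=\frac{\phi_s\times\phi_t}{|\phi_s\times\phi_t|}$. TreadmillSled: for a regular plane curve $\alpha$, for each $s$ let $T_s:\mathbb{R}^2\to\mathbb{R}^2$ be the unique orientation-preserving isometry that takes $\alpha(s)$ to $(0,0)$ and whose linear part takes the unit tangent vector $\alpha'(s)$ to $(1,0)$. The TreadmillSled of $\alpha$ is the curve $s\mapsto T_s(0,0)$. The range of $h_w$ is $[-\frac14,\infty)$, $h_w^{-1}(-\frac14)=\{(0,-\frac12)\}$, and for $M>-\frac14$ the level set $h_w^{-1}(M)$ is a regular simple closed curve; these level sets are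 called heart-shaped curves (for $M=-\frac14$ degenerating to a point). *)

theory Defs
  imports "HOL-Analysis.Analysis"
begin

primrec cont_diff :: "nat \<Rightarrow> ('a::euclidean_space \<Rightarrow> 'b::euclidean_space) \<Rightarrow> bool" where
  "cont_diff 0 f \<longleftrightarrow> continuous_on UNIV f"
| "cont_diff (Suc k) f \<longleftrightarrow>
     f differentiable_on UNIV \<and> (\<forall>v. cont_diff k (\<lambda>p. frechet_derivative f (at p) v))"

definition smooth :: "('a::euclidean_space \<Rightarrow> 'b::euclidean_space) \<Rightarrow> bool" where
  "smooth f \<longleftrightarrow> (\<forall>k. cont_diff k f)"

definition immersion :: "(real \<times> real \<Rightarrow> real^3) \<Rightarrow> bool" where
  "immersion \<phi> \<longleftrightarrow> smooth \<phi> \<and> (\<forall>p. inj (frechet_derivative \<phi> (at p)))"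

definition surface_normal :: "(real \<times> real \<Rightarrow> real^3) \<Rightarrow> real \<times> real \<Rightarrow> real^3" where
  "surface_normal \<phi> p =
     cross3 (frechet_derivative \<phi> (at p) (1, 0)) (frechet_derivative \<phi> (at p) (0, 1))"

definition gauss_map :: "(real \<times> real \<Rightarrow> real^3) \<Rightarrow> real \<times> real \<Rightarrow> real^3" where
  "gauss_map \<phi> p = surface_normal \<phi> p /\<^sub>R norm (surface_normal \<phi> p)"

(* The shape operator at p is S = - d(phi)^(-1) o d(nu), nu the Gauss map, so S v = k v reads
   d(nu) v = - k d(phi) v. With this sign a round cylinder has nonnegative principal curvatures
   when nu points inwards. *)
definition principal_direction ::
  "(real \<times> real \<Rightarrow> real^3) \<Rightarrow> real \<times> real \<Rightarrow> real \<Rightarrow> real \<times> real \<Rightarrow> bool" where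
  "principal_direction \<phi> p k v \<longleftrightarrow>
     v \<noteq> 0 \<and> frechet_derivative (gauss_map \<phi>) (at p) v = - k *\<^sub>R frechet_derivative \<phi> (at p) v"

(* Two linearly independent principal directions are required, so that each principal curvature
   is counted with its multiplicity (in particular k1 = k2 exactly at umbilics). *)
definition principal_curvatures ::
  "(real \<times> real \<Rightarrow> real^3) \<Rightarrow> real \<times> real \<Rightarrow> real \<Rightarrow> real \<Rightarrow> bool" where
  "principal_curvatures \<phi> p k1 k2 \<longleftrightarrow>
     (\<exists>v1 v2. v1 \<noteq> v2 \<and> independent {v1, v2} \<and>
        principal_direction \<phi> p k1 v1 \<and> principal_direction \<phi> p k2 v2)"

definition has_mean_curvature ::
  "(real \<times> real \<Rightarrow> real^3) \<Rightarrow> real \<times> real \<Rightarrow> real \<Rightarrow> bool" where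
  "has_mean_curvature \<phi> p H \<longleftrightarrow>
     (\<exists>k1 k2. principal_curvatures \<phi> p k1 k2 \<and> H = (k1 + k2) / 2)"

(* The components of the profile curve are x = alpha $ 1 and z = alpha $ 2. *)
definition twizzler_map :: "real \<Rightarrow> (real \<Rightarrow> real^2) \<Rightarrow> real \<times> real \<Rightarrow> real^3" where
  "twizzler_map w \<alpha> = (\<lambda>(s, t). vector
     [\<alpha> s $ 1 * cos (w * t) + \<alpha> s $ 2 * sin (w * t),
      t,
      - (\<alpha> s $ 1) * sin (w * t) + \<alpha> s $ 2 * cos (w * t)])"

definition arc_length_parametrized :: "(real \<Rightarrow> real^2) \<Rightarrow> bool" where
  "arc_length_parametrized \<alpha> \<longleftrightarrow>
     (\<forall>s. \<alpha> differentiable (at s) \<and> norm (vector_derivative \<alpha> (at s)) = 1)"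

definition cmc_twizzler :: "real \<Rightarrow> real \<Rightarrow> (real \<Rightarrow> real^2) \<Rightarrow> bool" where
  "cmc_twizzler w H \<alpha> \<longleftrightarrow>
     arc_length_parametrized \<alpha> \<and> immersion (twizzler_map w \<alpha>) \<and>
     (\<forall>p. has_mean_curvature (twizzler_map w \<alpha>) p H)"

(* An orientation-preserving isometry of the plane is an affine map whose linear part A is a
   rotation matrix. *)
definition sled_isometry :: "(real \<Rightarrow> real^2) \<Rightarrow> real \<Rightarrow> (real^2 \<Rightarrow> real^2) \<Rightarrow> bool" where
  "sled_isometry \<alpha> s T \<longleftrightarrow>
     (\<exists>A b. rotation_matrix A \<and> T = (\<lambda>p. A *v p + b) \<and>
        T (\<alpha> s) = 0 \<and> A *v sgn (vector_derivative \<alpha> (at s)) = vector [1, 0])"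

definition treadmill_sled :: "(real \<Rightarrow> real^2) \<Rightarrow> real \<Rightarrow> real^2" where
  "treadmill_sled \<alpha> s = (THE T. sled_isometry \<alpha> s T) 0"

definition heart_fun :: "real \<Rightarrow> real^2 \<Rightarrow> real" where
  "heart_fun w p = (p $ 1)\<^sup>2 + (p $ 2)\<^sup>2 + p $ 2 / sqrt (1 + w\<^sup>2 * (p $ 1)\<^sup>2)"

definition circular_cylinder :: "real \<Rightarrow> (real^3) set \<Rightarrow> bool" where
  "circular_cylinder r S \<longleftrightarrow>
     (\<exists>a v. v \<noteq> 0 \<and> S = {q. infdist q (range (\<lambda>\<tau>. a + \<tau> *\<^sub>R v)) = r})"

end

theory Submission
  imports Defs
begin

text \<open>
Let \<open>T\<close> be the unit tangent of the profile curve \<open>\<alpha>\<close> and \<open>\<kappa>\<close> its plane curvature. The point of the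
TreadmillSled at \<open>s\<close> is \<open>- (p, q)\<close>, where \<open>p = \<langle>\<alpha>, T\<rangle>\<close> and \<open>q = \<langle>\<alpha>, N\<rangle>\<close> are the components of
\<open>\<alpha>\<close> in the moving frame \<open>T, N\<close> (\<open>treadmill_sled_eq\<close>). The frame equations give
\<open>p' = 1 + \<kappa> q\<close> and \<open>q' = - \<kappa> p\<close>.

Mean curvature \<open>H\<close> of the helicoidal surface along the profile curve amounts to
\<open>\<kappa> (1 + w\<^sup>2 (p\<^sup>2 + q\<^sup>2)) + w\<^sup>2 q = 2 H W\<^sup>3\<close> with \<open>W\<^sup>2 = 1 + w\<^sup>2 p\<^sup>2\<close> (\<open>twizzler_curvature_equation\<close>),
because along that curve both fundamental forms are expressed by \<open>\<kappa>, p, q, w\<close> alone. Solved for \<open>\<kappa>\<close>, this turns the frame equations into an autonomous system in the plane.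

The level sets of the heart function become circles in the coordinates
\<open>u = p \<surd>(1 + w\<^sup>2 / (4 W\<^sup>2))\<close>, \<open>y = q + 1 / (2 W)\<close>: completing the square in \<open>q\<close> gives
\<open>h\<^sub>w + 1/4 = u\<^sup>2 + y\<^sup>2\<close>, and \<open>(p, q) \<mapsto> (u, y)\<close> is injective. For \<open>H = 1\<close> the system reads
\<open>u' = P y\<close>, \<open>y' = - P u\<close> in these coordinates, with \<open>P > 0\<close>. So the motion is a rotation whose
angular speed \<open>P\<close> has a positive lower bound, since it stays in a bounded region; it therefore runs
through one whole circle (\<open>rotation_flow_range\<close>), which is one whole level set
(\<open>heart_flow_range\<close>). The circle of radius zero is the level \<open>- 1 / 4\<close>, and it belongs to the
profile that is the circle of radius one half about the origin.
\<close>

section \<open>Rotations of variable angular speed\<close>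

text \<open>
An antiderivative \<open>F\<close> of the angular speed turns the motion into a uniform one: rotating back by \<open>F\<close>
gives a constant, so \<open>(u, y)\<close> is a fixed vector turned through the angle \<open>- F\<close>. The lower bound
makes \<open>F\<close> a surjection onto the reals, so that every angle occurs.
\<close>

lemma rotation_flow_range:
  fixes u y P :: "real \<Rightarrow> real"
  assumes u: "\<And>s. (u has_real_derivative P s * y s) (at s)"
    and y: "\<And>s. (y has_real_derivative - (P s * u s)) (at s)"
    and cont: "\<And>s. isCont P s"
    and c: "c > 0" "\<And>s. c \<le> P s"
  shows "range (\<lambda>s. (u s, y s)) = {q. (fst q)\<^sup>2 + (snd q)\<^sup>2 = (u 0)\<^sup>2 + (y 0)\<^sup>2}"
proof -
  have "\<exists>F. \<forall>s::real. -\<infinity> < ereal s \<longrightarrow> ereal s < \<infinity> \<longrightarrow> (F has_vector_derivative P s) (at s)"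
    by (rule einterval_antiderivative) (auto intro: cont)
  then obtain F where F: "\<And>s. (F has_real_derivative P s) (at s)"
    by (auto simp: has_real_derivative_iff_has_vector_derivative)
  have "\<exists>a. \<forall>s. u s * cos (F s) - y s * sin (F s) = a"
    by (rule has_field_derivative_zero_constant[where s=UNIV, simplified])
      (auto intro!: derivative_eq_intros u y F simp: algebra_simps)
  then obtain a where a: "\<And>s. u s * cos (F s) - y s * sin (F s) = a" by blast
  have "\<exists>b. \<forall>s. u s * sin (F s) + y s * cos (F s) = b"
    by (rule has_field_derivative_zero_constant[where s=UNIV, simplified])
      (auto intro!: derivative_eq_intros u y F simp: algebra_simps)
  then obtain b where b: "\<And>s. u s * sin (F s) + y s * cos (F s) = b" by blast
  obtain r \<gamma> where \<gamma>: "a = r * cos \<gamma>" "b = r * sin \<gamma>"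
    using polar_Ex by blast
  have sc: "(sin (F s))\<^sup>2 = 1 - (cos (F s))\<^sup>2" for s
    by (simp add: sin_squared_eq)
  have us: "u s = r * cos (\<gamma> - F s)" and ys: "y s = r * sin (\<gamma> - F s)" for s
  proof -
    have "u s = a * cos (F s) + b * sin (F s)"
      unfolding a[of s, symmetric] b[of s, symmetric] using sc[of s] by algebra
    then show "u s = r * cos (\<gamma> - F s)" by (simp add: \<gamma> cos_diff algebra_simps)
    have "y s = b * cos (F s) - a * sin (F s)"
      unfolding a[of s, symmetric] b[of s, symmetric] using sc[of s] by algebra
    then show "y s = r * sin (\<gamma> - F s)" by (simp add: \<gamma> sin_diff algebra_simps)
  qed
  have norm: "(u s)\<^sup>2 + (y s)\<^sup>2 = r\<^sup>2" for s
    by (simp add: us ys power_mult_distrib flip: distrib_left)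
  have growth: "c * (t - s) \<le> F t - F s" if "s \<le> t" for s t
  proof -
    have "F s - c * s \<le> F t - c * t"
      using that by (intro DERIV_nonneg_imp_nondecreasing[where f="\<lambda>x. F x - c * x"])
        (auto intro!: exI derivative_eq_intros F c(2))
    then show ?thesis by (simp add: algebra_simps)
  qed
  have surj: "\<exists>s. F s = v" for v
  proof -
    define d where "d = \<bar>v - F 0\<bar> / c"
    have "d \<ge> 0" "c * d = \<bar>v - F 0\<bar>" using c(1) by (auto simp: d_def)
    moreover have "F (-d) \<le> v" "v \<le> F d"
      using growth[of "-d" 0] growth[of 0 d] calculation by (auto simp: abs_if split: if_splits)
    moreover have "continuous_on {-d..d} F"
      using F by (meson DERIV_isCont continuous_at_imp_continuous_on)
    ultimately show ?thesis
      using IVT'[of F "-d" v d] by auto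
  qed
  have "q \<in> range (\<lambda>s. (u s, y s))" if "(fst q)\<^sup>2 + (snd q)\<^sup>2 = r\<^sup>2" for q
  proof -
    obtain r' \<beta>' where \<beta>': "fst q = r' * cos \<beta>'" "snd q = r' * sin \<beta>'"
      using polar_Ex by blast
    have "r'\<^sup>2 = r\<^sup>2"
      using that by (simp add: \<beta>' power_mult_distrib flip: distrib_left)
    \<comment> \<open>A polar radius of the wrong sign is corrected by turning through a half circle.\<close>
    then have "\<exists>\<beta>. fst q = r * cos \<beta> \<and> snd q = r * sin \<beta>"
      using \<beta>' by (auto simp: power2_eq_iff intro: exI[of _ \<beta>'] exI[of _ "\<beta>' + pi"])
    then obtain \<beta> where \<beta>: "fst q = r * cos \<beta>" "snd q = r * sin \<beta>" by blast
    obtain s where "F s = \<gamma> - \<beta>" using surj by blast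
    then have "q = (u s, y s)" by (simp add: us ys \<beta> prod_eq_iff)
    then show ?thesis by blast
  qed
  then show ?thesis using norm by auto
qed

section \<open>Coordinates that make the level sets round\<close>

text \<open>
The factor is chosen so that \<open>(heart_scale w x)\<^sup>2\<close> is what remains of the heart function, up to an
additive constant, after completing the square in the second variable; taking the root with the
sign of \<open>x\<close> makes the map injective.
\<close>

definition heart_scale :: "real \<Rightarrow> real \<Rightarrow> real" where
  "heart_scale w x = x * sqrt (1 + w\<^sup>2 / (4 * (1 + w\<^sup>2 * x\<^sup>2)))"

definition heart_coords :: "real \<Rightarrow> real^2 \<Rightarrow> real \<times> real" where
  "heart_coords w p = (heart_scale w (p $ 1), p $ 2 + 1 / (2 * sqrt (1 + w\<^sup>2 * (p $ 1)\<^sup>2)))"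

lemma one_plus_square_pos: "0 < 1 + w\<^sup>2 * (x::real)\<^sup>2"
  by (simp add: add_pos_nonneg)

lemma heart_scale_square: "(heart_scale w x)\<^sup>2 = x\<^sup>2 + 1 / 4 - 1 / (4 * (1 + w\<^sup>2 * x\<^sup>2))"
proof -
  have "(sqrt (1 + w\<^sup>2 / (4 * (1 + w\<^sup>2 * x\<^sup>2))))\<^sup>2 = 1 + w\<^sup>2 / (4 * (1 + w\<^sup>2 * x\<^sup>2))"
    by simp
  then show ?thesis
    using one_plus_square_pos[of w x]
    by (simp add: heart_scale_def power_mult_distrib) (simp add: field_simps)
qed

text \<open>The square of the scaled coordinate is a strictly increasing function of \<open>x\<^sup>2\<close>, and scaling keeps the sign.\<close>

lemma inj_heart_scale: "inj (heart_scale w)"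
proof (rule injI)
  fix a b assume eq: "heart_scale w a = heart_scale w b"
  have pos: "0 < sqrt (1 + w\<^sup>2 / (4 * (1 + w\<^sup>2 * x\<^sup>2)))" for x
    using one_plus_square_pos[of w x] by (simp add: add_pos_nonneg)
  have sgn: "sgn (heart_scale w x) = sgn x" for x
    using pos[of x] by (simp add: heart_scale_def sgn_mult)
  have less: "(heart_scale w a)\<^sup>2 < (heart_scale w b)\<^sup>2" if "a\<^sup>2 < b\<^sup>2" for a b
  proof -
    have "1 / (4 * (1 + w\<^sup>2 * b\<^sup>2)) \<le> 1 / (4 * (1 + w\<^sup>2 * a\<^sup>2))"
      using that one_plus_square_pos[of w a] one_plus_square_pos[of w b]
      by (intro divide_left_mono mult_pos_pos) (auto simp: mult_left_mono)
    then show ?thesis using that unfolding heart_scale_square by linarith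
  qed
  have "a\<^sup>2 = b\<^sup>2"
    using less[of a b] less[of b a] eq by (metis less_irrefl linorder_neqE_linordered_idom)
  moreover have "sgn a = sgn b" using eq sgn by metis
  ultimately show "a = b" by (auto simp: power2_eq_iff sgn_if split: if_splits)
qed

lemma inj_heart_coords: "inj (heart_coords w)"
proof (rule injI)
  fix p q assume "heart_coords w p = heart_coords w q"
  then have "heart_scale w (p $ 1) = heart_scale w (q $ 1)"
    and 2: "p $ 2 + 1 / (2 * sqrt (1 + w\<^sup>2 * (p $ 1)\<^sup>2)) = q $ 2 + 1 / (2 * sqrt (1 + w\<^sup>2 * (q $ 1)\<^sup>2))"
    by (auto simp: heart_coords_def)
  then have "p $ 1 = q $ 1" using inj_heart_scale by (meson injD)
  with 2 show "p = q" by (simp add: vec_eq_iff forall_2)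
qed

text \<open>With \<open>q\<close> the second component and \<open>W\<close> the root in \<open>heart_fun_def\<close>, \<open>(1 / (2 W))\<^sup>2\<close> is the term that completes \<open>q\<^sup>2 + q / W\<close>.\<close>

lemma heart_fun_eq_norm_coords:
  "heart_fun w p = (fst (heart_coords w p))\<^sup>2 + (snd (heart_coords w p))\<^sup>2 - 1 / 4"
proof -
  define W where "W = sqrt (1 + w\<^sup>2 * (p $ 1)\<^sup>2)"
  have W: "W > 0" "W\<^sup>2 = 1 + w\<^sup>2 * (p $ 1)\<^sup>2"
    using one_plus_square_pos[of w "p $ 1"] by (auto simp: W_def)
  show ?thesis
    unfolding heart_coords_def heart_fun_def fst_conv snd_conv heart_scale_square W_def[symmetric] W(2)[symmetric]
    using W(1) by (simp add: power2_eq_square field_simps)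
qed

lemma has_real_derivative_heart_scale:
  "(heart_scale w has_real_derivative
     (1 + w\<^sup>2 / (4 * (1 + w\<^sup>2 * x\<^sup>2)\<^sup>2)) / sqrt (1 + w\<^sup>2 / (4 * (1 + w\<^sup>2 * x\<^sup>2)))) (at x)"
proof -
  define V where "V = 1 + w\<^sup>2 * x\<^sup>2"
  define Q where "Q = sqrt (1 + w\<^sup>2 / (4 * V))"
  have V: "V > 0" unfolding V_def by (rule one_plus_square_pos)
  have Q: "Q > 0" "Q\<^sup>2 = 1 + w\<^sup>2 / (4 * V)"
    using V by (auto simp: Q_def add_pos_nonneg)
  have V0: "4 * (1 + w\<^sup>2 * x\<^sup>2) \<noteq> 0" using V by (simp add: V_def)
  have "((\<lambda>x. 1 + w\<^sup>2 / (4 * (1 + w\<^sup>2 * x\<^sup>2))) has_real_derivative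
      - (w\<^sup>2 * (8 * w\<^sup>2 * x)) / (4 * V)\<^sup>2) (at x)"
    using V0 by (auto intro!: derivative_eq_intros simp: V_def power2_eq_square)
  from DERIV_chain2[OF DERIV_real_sqrt this]
  have "((\<lambda>x. sqrt (1 + w\<^sup>2 / (4 * (1 + w\<^sup>2 * x\<^sup>2)))) has_real_derivative
      inverse Q / 2 * (- (w\<^sup>2 * (8 * w\<^sup>2 * x)) / (4 * V)\<^sup>2)) (at x)"
    using Q(1) by (simp add: Q_def V_def)
  from DERIV_mult[OF DERIV_ident this]
  have "(heart_scale w has_real_derivative
     Q + x * ((- (w\<^sup>2 * (8 * w\<^sup>2 * x)) / (4 * V)\<^sup>2) * (inverse Q / 2))) (at x)"
    unfolding heart_scale_def[abs_def] by (simp add: Q_def V_def algebra_simps)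
  moreover have "Q + x * ((- (w\<^sup>2 * (8 * w\<^sup>2 * x)) / (4 * V)\<^sup>2) * (inverse Q / 2)) =
      (Q\<^sup>2 - w\<^sup>2 * (w\<^sup>2 * x\<^sup>2) / (4 * V\<^sup>2)) / Q"
    using V Q(1) by (simp add: field_simps power2_eq_square)
  moreover have "Q\<^sup>2 - w\<^sup>2 * (w\<^sup>2 * x\<^sup>2) / (4 * V\<^sup>2) = 1 + w\<^sup>2 / (4 * V\<^sup>2)"
  proof -
    have wx: "w\<^sup>2 * x\<^sup>2 = V - 1" by (simp add: V_def)
    show ?thesis unfolding Q(2) wx
      using V by (simp add: field_simps power2_eq_square)
  qed
  ultimately show ?thesis unfolding V_def[symmetric] Q_def[symmetric] by (simp only:)
qed

section \<open>The flow along a heart-shaped curve\<close>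

text \<open>
The curvature condition makes the vector \<open>(1 + \<kappa> q, - \<kappa> p)\<close> a positive multiple of the gradient of
the heart function turned by a right angle. Both the conservation of the heart function and the
direction of travel are read off from the rotation form in the round coordinates. The explicit lower
bound on the angular speed is needed because a positive speed alone could leave part of the level
set unvisited.
\<close>

lemma heart_flow_range:
  fixes p q \<kappa> :: "real \<Rightarrow> real"
  assumes p: "\<And>s. (p has_real_derivative 1 + \<kappa> s * q s) (at s)"
    and q: "\<And>s. (q has_real_derivative - (\<kappa> s * p s)) (at s)"
    and \<kappa>: "\<And>s. \<kappa> s * (1 + w\<^sup>2 * ((p s)\<^sup>2 + (q s)\<^sup>2)) + w\<^sup>2 * q s = 2 * sqrt (1 + w\<^sup>2 * (p s)\<^sup>2) ^ 3"
  shows "\<exists>M \<ge> - 1 / 4. range (\<lambda>s. vector [p s, q s]) = {x. heart_fun w x = M}"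
proof -
  define \<xi> where "\<xi> s = (vector [p s, q s] :: real^2)" for s
  define u where "u s = fst (heart_coords w (\<xi> s))" for s
  define y where "y s = snd (heart_coords w (\<xi> s))" for s
  define W where "W s = sqrt (1 + w\<^sup>2 * (p s)\<^sup>2)" for s
  define D where "D s = 1 + w\<^sup>2 * ((p s)\<^sup>2 + (q s)\<^sup>2)" for s
  define Q where "Q s = sqrt (1 + w\<^sup>2 / (4 * (W s)\<^sup>2))" for s
  define A where "A s = 1 + w\<^sup>2 / (4 * (W s) ^ 4)" for s
  define P where "P s = A s / Q s * (2 * W s ^ 3 / D s)" for s
  have W2: "(W s)\<^sup>2 = 1 + w\<^sup>2 * (p s)\<^sup>2" for s
    using one_plus_square_pos[of w "p s"] by (simp add: W_def)
  have W4: "(W s) ^ 4 = (1 + w\<^sup>2 * (p s)\<^sup>2)\<^sup>2" for s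
    by (simp flip: W2)
  have W1: "1 \<le> W s" for s by (simp add: W_def)
  have Wpos: "0 < W s" for s using W1[of s] by linarith
  have D1: "1 \<le> D s" for s by (simp add: D_def)
  have Dpos: "0 < D s" for s using D1[of s] by linarith
  have Qpos: "0 < Q s" for s using Wpos[of s] by (simp add: Q_def add_pos_nonneg)
  have u_eq: "u s = p s * Q s" for s
    by (simp add: u_def heart_coords_def heart_scale_def \<xi>_def Q_def W2)
  have y_eq: "y s = q s + 1 / (2 * W s)" for s
    by (simp add: y_def heart_coords_def \<xi>_def W_def)
  have \<kappa>_eq: "\<kappa> s = (2 * W s ^ 3 - w\<^sup>2 * q s) / D s" for s
    using \<kappa>[of s] Dpos[of s] unfolding D_def W_def by (simp add: eq_divide_eq algebra_simps)
  \<comment> \<open>The derivative of the heart function in its second variable is \<open>2 y\<close>; the velocity is its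
      turned gradient times \<open>W\<^sup>3 / D\<close>.\<close>
  have p_speed: "1 + \<kappa> s * q s = 2 * W s ^ 3 / D s * y s" for s
  proof -
    have D: "D s = (W s)\<^sup>2 + w\<^sup>2 * (q s)\<^sup>2" by (simp add: D_def W2 algebra_simps)
    have "2 * W s ^ 3 * y s = 2 * W s ^ 3 * q s + (W s)\<^sup>2"
      using Wpos[of s] by (simp add: y_eq distrib_left power2_eq_square power3_eq_cube)
    then have "D s + (2 * W s ^ 3 - w\<^sup>2 * q s) * q s = 2 * W s ^ 3 * y s"
      unfolding D by (simp add: algebra_simps power2_eq_square)
    then show ?thesis using Dpos[of s] unfolding \<kappa>_eq by (simp add: add_divide_distrib[symmetric] divide_simps)
  qed
  have u': "(u has_real_derivative P s * y s) (at s)" for s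
  proof -
    have "((\<lambda>s. heart_scale w (p s)) has_real_derivative A s / Q s * (1 + \<kappa> s * q s)) (at s)"
      using DERIV_chain2[OF has_real_derivative_heart_scale p] by (simp add: A_def Q_def W2 W4)
    moreover have "u = (\<lambda>s. heart_scale w (p s))"
      by (auto simp: u_def heart_coords_def \<xi>_def)
    ultimately show ?thesis by (simp add: p_speed P_def mult.assoc)
  qed
  have W': "(W has_real_derivative w\<^sup>2 * p s * (1 + \<kappa> s * q s) / W s) (at s)" for s
  proof -
    have "((\<lambda>s. 1 + w\<^sup>2 * (p s)\<^sup>2) has_real_derivative 2 * w\<^sup>2 * p s * (1 + \<kappa> s * q s)) (at s)"
      by (auto intro!: derivative_eq_intros p)
    from DERIV_chain2[OF DERIV_real_sqrt this] one_plus_square_pos[of w "p s"]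
    have "(W has_real_derivative inverse (W s) / 2 * (2 * w\<^sup>2 * p s * (1 + \<kappa> s * q s))) (at s)"
      unfolding W_def[abs_def] by simp
    moreover have "inverse (W s) / 2 * (2 * w\<^sup>2 * p s * (1 + \<kappa> s * q s)) =
        w\<^sup>2 * p s * (1 + \<kappa> s * q s) / W s"
      using Wpos[of s] by (simp add: field_simps)
    ultimately show ?thesis by (simp only:)
  qed
  have y': "(y has_real_derivative - (P s * u s)) (at s)" for s
  proof -
    have "((\<lambda>s. inverse (W s) / 2) has_real_derivative - (w\<^sup>2 * p s * (1 + \<kappa> s * q s) / (2 * W s ^ 3))) (at s)"
    proof -
      have "W s \<noteq> 0" using Wpos[of s] by simp
      from DERIV_cdivide[OF DERIV_inverse'[OF W'[of s] this], of 2] show ?thesis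
        by (rule DERIV_cong) (use Wpos[of s] in \<open>simp add: field_simps power3_eq_cube\<close>)
    qed
    moreover have "y = (\<lambda>s. q s + inverse (W s) / 2)"
      by (auto simp: y_eq inverse_eq_divide)
    ultimately have "(y has_real_derivative - (\<kappa> s * p s) - w\<^sup>2 * p s * (1 + \<kappa> s * q s) / (2 * W s ^ 3)) (at s)"
      using DERIV_add[OF q[of s]] by fastforce
    moreover have "w\<^sup>2 * p s * (1 + \<kappa> s * q s) / (2 * W s ^ 3) = w\<^sup>2 * p s * y s / D s"
      unfolding p_speed using Wpos[of s] by simp
    moreover have "- (\<kappa> s * p s) - w\<^sup>2 * p s * y s / D s = - (2 * W s ^ 3 / D s * (p s * A s))"
    proof -
      have "2 * W s ^ 3 * A s = 2 * W s ^ 3 - w\<^sup>2 * q s + w\<^sup>2 * y s"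
        using Wpos[of s] by (simp add: A_def y_eq field_simps power3_eq_cube power4_eq_xxxx)
      then have "2 * W s ^ 3 / D s * (p s * A s) = (2 * W s ^ 3 - w\<^sup>2 * q s + w\<^sup>2 * y s) * p s / D s"
        by (simp add: mult_ac)
      then show ?thesis unfolding \<kappa>_eq by (simp add: add_divide_distrib diff_divide_distrib algebra_simps)
    qed
    moreover have "P s * u s = 2 * W s ^ 3 / D s * (p s * A s)"
      using Qpos[of s] by (simp add: P_def u_eq)
    ultimately show ?thesis by simp
  qed
  have contp: "isCont p s" and contq: "isCont q s" for s
    using p q DERIV_isCont by blast+
  have contP: "isCont P s" for s
    using Wpos[of s] Dpos[of s] Qpos[of s] contp[of s] contq[of s] unfolding P_def A_def Q_def D_def W_def
    by (intro continuous_intros) auto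
  have const: "(u s)\<^sup>2 + (y s)\<^sup>2 = (u 0)\<^sup>2 + (y 0)\<^sup>2" for s
  proof -
    have "\<exists>a. \<forall>s. (u s)\<^sup>2 + (y s)\<^sup>2 = a"
      by (rule has_field_derivative_zero_constant[where s=UNIV, simplified])
        (auto intro!: derivative_eq_intros u' y' simp: algebra_simps)
    then show ?thesis by metis
  qed
  \<comment> \<open>The orbit stays in a bounded region, where \<open>D\<close> is bounded above and so the speed \<open>P\<close> below.\<close>
  define R where "R = sqrt ((u 0)\<^sup>2 + (y 0)\<^sup>2)"
  have u_le: "\<bar>u s\<bar> \<le> R" and y_le: "\<bar>y s\<bar> \<le> R" for s
    unfolding R_def const[of s, symmetric] by (auto intro!: real_le_rsqrt)
  have p_le: "\<bar>p s\<bar> \<le> R" for s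
  proof -
    have "1 \<le> Q s" by (simp add: Q_def)
    then have "\<bar>p s\<bar> \<le> \<bar>u s\<bar>" by (simp add: u_eq abs_mult mult_le_cancel_left1)
    then show ?thesis using u_le[of s] by linarith
  qed
  have q_le: "\<bar>q s\<bar> \<le> R + 1" for s
  proof -
    have "0 \<le> 1 / (2 * W s)" "1 / (2 * W s) \<le> 1" using W1[of s] Wpos[of s] by auto
    then show ?thesis using y_le[of s] unfolding y_eq by linarith
  qed
  define B where "B = 1 + w\<^sup>2 * (R\<^sup>2 + (R + 1)\<^sup>2)"
  have D_le: "D s \<le> B" for s
    unfolding D_def B_def using p_le[of s] q_le[of s]
    by (intro add_left_mono mult_left_mono add_mono abs_le_square_iff[THEN iffD1]) auto
  have B: "0 < B" using D_le Dpos by (meson less_le_trans)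
  have P_ge: "2 / (sqrt (1 + w\<^sup>2 / 4) * B) \<le> P s" for s
  proof -
    have "1 \<le> A s" using Wpos[of s] by (simp add: A_def)
    moreover have "Q s \<le> sqrt (1 + w\<^sup>2 / 4)"
    proof -
      have "w\<^sup>2 * 1 \<le> w\<^sup>2 * (W s)\<^sup>2" using W1[of s] by (intro mult_left_mono) auto
      then show ?thesis using Wpos[of s] by (simp add: Q_def field_simps)
    qed
    ultimately have "1 / sqrt (1 + w\<^sup>2 / 4) \<le> A s / Q s"
      using Qpos[of s] by (intro frac_le) auto
    moreover have "2 / B \<le> 2 * W s ^ 3 / D s"
      using D_le[of s] Dpos[of s] W1[of s] by (intro frac_le) auto
    ultimately have "1 / sqrt (1 + w\<^sup>2 / 4) * (2 / B) \<le> P s"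
      unfolding P_def using B by (intro mult_mono) (auto intro: order_trans[rotated])
    then show ?thesis by simp
  qed
  have "0 < 2 / (sqrt (1 + w\<^sup>2 / 4) * B)"
    using B by (simp add: add_pos_nonneg)
  from rotation_flow_range[OF u' y' contP this P_ge]
  have circle: "range (\<lambda>s. heart_coords w (\<xi> s)) = {z. (fst z)\<^sup>2 + (snd z)\<^sup>2 = (u 0)\<^sup>2 + (y 0)\<^sup>2}"
    by (simp add: u_def y_def)
  define M where "M = (u 0)\<^sup>2 + (y 0)\<^sup>2 - 1 / 4"
  have "x \<in> range \<xi> \<longleftrightarrow> heart_fun w x = M" for x
  proof -
    have "x \<in> range \<xi> \<longleftrightarrow> heart_coords w x \<in> range (\<lambda>s. heart_coords w (\<xi> s))"
      using inj_heart_coords[of w] by (auto dest: injD)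
    then show ?thesis by (auto simp: circle heart_fun_eq_norm_coords M_def)
  qed
  moreover have "M \<ge> - 1 / 4" by (simp add: M_def)
  ultimately show ?thesis unfolding \<xi>_def by blast
qed

section \<open>The moving frame and the TreadmillSled\<close>

definition cross2 :: "real^2 \<Rightarrow> real^2 \<Rightarrow> real" where
  "cross2 a b = a $ 1 * b $ 2 - a $ 2 * b $ 1"

lemma has_real_derivative_component:
  assumes "(\<alpha> has_vector_derivative a) (at s)"
  shows "((\<lambda>s. \<alpha> s $ i) has_real_derivative a $ i) (at s)"
  using bounded_linear.has_vector_derivative[OF bounded_linear_vec_nth assms]
  by (simp add: has_real_derivative_iff_has_vector_derivative)

text \<open>
Since \<open>T\<close> has unit length, \<open>T'\<close> is \<open>\<kappa>\<close> times the left normal \<open>(- T\<^sub>2, T\<^sub>1)\<close>, with \<open>\<kappa> = cross2 T T'\<close>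
the signed curvature. The last two claims follow by the product rule.
\<close>

lemma frame_equations:
  fixes \<alpha> T :: "real \<Rightarrow> real^2"
  assumes \<alpha>: "(\<alpha> has_vector_derivative T s) (at s)"
    and unit: "\<And>s. norm (T s) = 1"
    and T: "(T has_vector_derivative T') (at s)"
  defines "\<kappa> \<equiv> cross2 (T s) T'"
  shows "T' $ 1 = - \<kappa> * T s $ 2" "T' $ 2 = \<kappa> * T s $ 1"
    and "((\<lambda>s. \<alpha> s \<bullet> T s) has_real_derivative 1 + \<kappa> * cross2 (T s) (\<alpha> s)) (at s)"
    and "((\<lambda>s. cross2 (T s) (\<alpha> s)) has_real_derivative - (\<kappa> * (\<alpha> s \<bullet> T s))) (at s)"
proof -
  have unit': "(T s $ 1)\<^sup>2 + (T s $ 2)\<^sup>2 = 1" for s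
    using unit[of s] by (simp add: norm_vec_def L2_set_def sum_2)
  note T_i = has_real_derivative_component[OF T] and \<alpha>_i = has_real_derivative_component[OF \<alpha>]
  have "((\<lambda>s. (T s $ 1)\<^sup>2 + (T s $ 2)\<^sup>2) has_real_derivative
      2 * (T s $ 1 * T' $ 1 + T s $ 2 * T' $ 2)) (at s)"
    by (auto intro!: derivative_eq_intros T_i)
  then have "((\<lambda>_. 1) has_real_derivative 2 * (T s $ 1 * T' $ 1 + T s $ 2 * T' $ 2)) (at s)"
    unfolding unit' .
  then have perp: "T s $ 1 * T' $ 1 + T s $ 2 * T' $ 2 = 0"
    using DERIV_unique[OF _ DERIV_const] by fastforce
  show T'1: "T' $ 1 = - \<kappa> * T s $ 2" and T'2: "T' $ 2 = \<kappa> * T s $ 1"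
    using unit'[of s] perp unfolding \<kappa>_def cross2_def by algebra+
  have "((\<lambda>s. \<alpha> s \<bullet> T s) has_real_derivative
      T s $ 1 * T s $ 1 + \<alpha> s $ 1 * T' $ 1 + (T s $ 2 * T s $ 2 + \<alpha> s $ 2 * T' $ 2)) (at s)"
    unfolding inner_vec_def sum_2 inner_real_def
    by (auto intro!: derivative_eq_intros \<alpha>_i T_i)
  moreover have "T s $ 1 * T s $ 1 + \<alpha> s $ 1 * T' $ 1 + (T s $ 2 * T s $ 2 + \<alpha> s $ 2 * T' $ 2)
      = 1 + \<kappa> * cross2 (T s) (\<alpha> s)"
    using unit'[of s] unfolding T'1 T'2 cross2_def by algebra
  ultimately show "((\<lambda>s. \<alpha> s \<bullet> T s) has_real_derivative 1 + \<kappa> * cross2 (T s) (\<alpha> s)) (at s)"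
    by simp
  have "((\<lambda>s. cross2 (T s) (\<alpha> s)) has_real_derivative
      (T' $ 1 * \<alpha> s $ 2 + T s $ 2 * T s $ 1) - (T' $ 2 * \<alpha> s $ 1 + T s $ 1 * T s $ 2)) (at s)"
    unfolding cross2_def by (auto intro!: derivative_eq_intros \<alpha>_i T_i)
  moreover have "(T' $ 1 * \<alpha> s $ 2 + T s $ 2 * T s $ 1) - (T' $ 2 * \<alpha> s $ 1 + T s $ 1 * T s $ 2)
      = - (\<kappa> * (\<alpha> s \<bullet> T s))"
    unfolding T'1 T'2 inner_vec_def sum_2 inner_real_def by algebra
  ultimately show "((\<lambda>s. cross2 (T s) (\<alpha> s)) has_real_derivative - (\<kappa> * (\<alpha> s \<bullet> T s))) (at s)"
    by simp
qed

text \<open>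
A rotation is determined by the image of one unit vector, so the isometry that defines the
TreadmillSled exists and is unique.
\<close>

lemma sled_isometry_iff:
  fixes \<alpha> :: "real \<Rightarrow> real^2"
  assumes \<alpha>: "(\<alpha> has_vector_derivative T) (at s)" and unit: "norm T = 1"
  shows "sled_isometry \<alpha> s S \<longleftrightarrow>
    S = (\<lambda>p. vector [vector [T $ 1, T $ 2], vector [- (T $ 2), T $ 1]] *v (p - \<alpha> s))"
proof -
  define R where "R = (vector [vector [T $ 1, T $ 2], vector [- (T $ 2), T $ 1]] :: real^2^2)"
  have T: "(T $ 1)\<^sup>2 + (T $ 2)\<^sup>2 = 1"
    using unit by (simp add: norm_vec_def L2_set_def sum_2)
  have [simp]: "sgn (vector_derivative \<alpha> (at s)) = T"
    using vector_derivative_at[OF \<alpha>] unit by (simp add: sgn_div_norm)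
  have R: "rotation_matrix R" "R *v T = vector [1, 0]"
    using T by (auto simp: rotation_matrix_def orthogonal_matrix_def R_def det_2 vec_eq_iff forall_2
      matrix_matrix_mult_def matrix_vector_mult_def transpose_def mat_def sum_2 power2_eq_square algebra_simps)
  have uniq: "A = R" if "rotation_matrix A" "A *v T = vector [1, 0]" for A
  proof -
    have A: "A $ 1 $ 1 * A $ 1 $ 1 + A $ 2 $ 1 * A $ 2 $ 1 = 1"
        "A $ 1 $ 1 * A $ 1 $ 2 + A $ 2 $ 1 * A $ 2 $ 2 = 0"
        "A $ 1 $ 2 * A $ 1 $ 2 + A $ 2 $ 2 * A $ 2 $ 2 = 1"
        "A $ 1 $ 1 * A $ 2 $ 2 - A $ 1 $ 2 * A $ 2 $ 1 = 1"
        "A $ 1 $ 1 * T $ 1 + A $ 1 $ 2 * T $ 2 = 1"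
        "A $ 2 $ 1 * T $ 1 + A $ 2 $ 2 * T $ 2 = 0"
      using that by (auto simp: rotation_matrix_def orthogonal_matrix_def det_2 vec_eq_iff forall_2
        matrix_matrix_mult_def matrix_vector_mult_def transpose_def mat_def sum_2)
    have "A $ 1 $ 1 = T $ 1" "A $ 1 $ 2 = T $ 2" "A $ 2 $ 1 = - (T $ 2)" "A $ 2 $ 2 = T $ 1"
      using A T by algebra+
    then show ?thesis by (simp add: R_def vec_eq_iff forall_2)
  qed
  show ?thesis unfolding R_def[symmetric]
  proof
    assume "sled_isometry \<alpha> s S"
    then obtain A b where A: "rotation_matrix A" "S = (\<lambda>p. A *v p + b)" "A *v \<alpha> s + b = 0" "A *v T = vector [1, 0]"
      by (auto simp: sled_isometry_def)
    have "b = - (R *v \<alpha> s)" using A uniq by (simp add: add_eq_0_iff)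
    then show "S = (\<lambda>p. R *v (p - \<alpha> s))"
      using A uniq by (simp add: matrix_vector_mult_diff_distrib)
  next
    assume "S = (\<lambda>p. R *v (p - \<alpha> s))"
    then show "sled_isometry \<alpha> s S"
      unfolding sled_isometry_def
      by (intro exI[of _ R] exI[of _ "- (R *v \<alpha> s)"]) (simp add: R matrix_vector_mult_diff_distrib)
  qed
qed

lemma treadmill_sled_eq:
  fixes \<alpha> :: "real \<Rightarrow> real^2"
  assumes "(\<alpha> has_vector_derivative T) (at s)" "norm T = 1"
  shows "treadmill_sled \<alpha> s = - vector [\<alpha> s \<bullet> T, cross2 T (\<alpha> s)]"
  unfolding treadmill_sled_def sled_isometry_iff[OF assms] the_eq_trivial
  by (simp add: vec_eq_iff forall_2 matrix_vector_mult_def sum_2 inner_vec_def cross2_def algebra_simps)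

section \<open>The trace of the shape operator\<close>

text \<open>
The matrices with entries \<open>E, F, F, G\<close> and \<open>e, f, f, g\<close> are the first and second fundamental
forms \<open>A\<close> and \<open>B\<close>, and \<open>k, l\<close> are eigenvalues of \<open>B\<close> relative to \<open>A\<close>. Polarizing the
identity \<open>det(B v, B u) = det B det(v, u)\<close> in \<open>B\<close> yields
\<open>det(B v, A u) + det(A v, B u) = (e G - 2 f F + g E) det(v, u)\<close>, while the eigenvector equations
turn the left side into \<open>(k + l) det A det(v, u)\<close>.
\<close>

lemma sum_of_eigenvalues_eq_mixed_discriminant:
  fixes E F G e f g :: real
  assumes indep: "v1 * u2 - v2 * u1 \<noteq> 0"
    and v: "e * v1 + f * v2 = k * (E * v1 + F * v2)" "f * v1 + g * v2 = k * (F * v1 + G * v2)"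
    and u: "e * u1 + f * u2 = l * (E * u1 + F * u2)" "f * u1 + g * u2 = l * (F * u1 + G * u2)"
  shows "e * G - 2 * f * F + g * E = (k + l) * (E * G - F\<^sup>2)"
proof -
  have "(v1 * u2 - v2 * u1) * (e * G - 2 * f * F + g * E) =
      (e * v1 + f * v2) * (F * u1 + G * u2) - (f * v1 + g * v2) * (E * u1 + F * u2)
      + (E * v1 + F * v2) * (f * u1 + g * u2) - (F * v1 + G * v2) * (e * u1 + f * u2)"
    by algebra
  also have "\<dots> = (v1 * u2 - v2 * u1) * ((k + l) * (E * G - F\<^sup>2))"
    unfolding v u by algebra
  finally show ?thesis using indep by simp
qed

lemma independent_pair_det_nonzero:
  fixes v u :: "real \<times> real"
  assumes "v \<noteq> u" "independent {v, u}"
  shows "fst v * snd u - snd v * fst u \<noteq> 0"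
proof
  assume det: "fst v * snd u - snd v * fst u = 0"
  have "v \<notin> span {u}" "u \<noteq> 0"
    using assms by (auto simp: independent_insert)
  then have neq: "v \<noteq> c *\<^sub>R u" for c by (auto simp: span_singleton)
  show False
  proof (cases "fst u = 0")
    case True
    then have "v = (snd v / snd u) *\<^sub>R u" using det \<open>u \<noteq> 0\<close> by (auto simp: prod_eq_iff)
    then show False using neq by blast
  next
    case False
    then have "v = (fst v / fst u) *\<^sub>R u" using det by (auto simp: prod_eq_iff field_simps)
    then show False using neq by blast
  qed
qed

section \<open>The mean curvature of a Twizzler\<close>

lemma has_derivative_vector_3:
  fixes f g h :: "'a::real_normed_vector \<Rightarrow> real"
  assumes "(f has_derivative f') F" "(g has_derivative g') F" "(h has_derivative h') F"
  shows "((\<lambda>x. vector [f x, g x, h x] :: real^3) has_derivative (\<lambda>v. vector [f' v, g' v, h' v])) F"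
proof -
  have eq: "(vector [a, b, c] :: real^3) = a *\<^sub>R axis 1 1 + b *\<^sub>R axis 2 1 + c *\<^sub>R axis 3 1" for a b c
    by (simp add: vec_eq_iff forall_3 axis_def)
  show ?thesis unfolding eq by (intro derivative_intros assms)
qed

lemma has_derivative_fst_coordinate:
  fixes f :: "real \<Rightarrow> real"
  assumes "(f has_real_derivative f') (at s)"
  shows "((\<lambda>p. f (fst p)) has_derivative (\<lambda>v. f' * fst v)) (at (s, t :: real))"
  using has_derivative_compose[OF has_derivative_fst[OF has_derivative_ident], of f "(*) f'" "(s,t)" UNIV] assms
  by (simp add: has_field_derivative_def)

context
  fixes w :: real and \<alpha> T :: "real \<Rightarrow> real^2"
  assumes \<alpha>: "\<And>s. (\<alpha> has_vector_derivative T s) (at s)"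
begin

lemma twizzler_map_has_derivative:
  "(twizzler_map w \<alpha> has_derivative
     (\<lambda>v. vector
       [fst v * (T s $ 1 * cos (w * t) + T s $ 2 * sin (w * t)) + snd v * (w * (\<alpha> s $ 2 * cos (w * t) - \<alpha> s $ 1 * sin (w * t))),
        snd v,
        fst v * (T s $ 2 * cos (w * t) - T s $ 1 * sin (w * t)) - snd v * (w * (\<alpha> s $ 1 * cos (w * t) + \<alpha> s $ 2 * sin (w * t)))]))
   (at (s, t))"
proof -
  have "twizzler_map w \<alpha> = (\<lambda>p. vector
     [\<alpha> (fst p) $ 1 * cos (w * snd p) + \<alpha> (fst p) $ 2 * sin (w * snd p), snd p,
      - (\<alpha> (fst p) $ 1) * sin (w * snd p) + \<alpha> (fst p) $ 2 * cos (w * snd p)])"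
    by (auto simp: twizzler_map_def)
  moreover have "\<And>i. ((\<lambda>p. \<alpha> (fst p) $ i) has_derivative (\<lambda>v. T s $ i * fst v)) (at (s, t))"
    by (intro has_derivative_fst_coordinate[of "\<lambda>s. \<alpha> s $ _"] has_real_derivative_component \<alpha>)
  ultimately show ?thesis
    by (auto intro!: derivative_eq_intros has_derivative_vector_3 simp: algebra_simps)
qed

lemma frechet_derivative_twizzler_map:
  "frechet_derivative (twizzler_map w \<alpha>) (at (s, t)) v =
     vector
       [fst v * (T s $ 1 * cos (w * t) + T s $ 2 * sin (w * t)) + snd v * (w * (\<alpha> s $ 2 * cos (w * t) - \<alpha> s $ 1 * sin (w * t))),
        snd v,
        fst v * (T s $ 2 * cos (w * t) - T s $ 1 * sin (w * t)) - snd v * (w * (\<alpha> s $ 1 * cos (w * t) + \<alpha> s $ 2 * sin (w * t)))]"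
  unfolding frechet_derivative_at[OF twizzler_map_has_derivative, symmetric] ..

lemma surface_normal_twizzler_map:
  "surface_normal (twizzler_map w \<alpha>) (s, t) = vector
     [T s $ 1 * sin (w * t) - T s $ 2 * cos (w * t),
      w * (\<alpha> s \<bullet> T s),
      T s $ 1 * cos (w * t) + T s $ 2 * sin (w * t)]"
proof -
  have "(T s $ 2 * cos (w * t) - T s $ 1 * sin (w * t)) * (w * (\<alpha> s $ 2 * cos (w * t) - \<alpha> s $ 1 * sin (w * t)))
      + (T s $ 1 * cos (w * t) + T s $ 2 * sin (w * t)) * (w * (\<alpha> s $ 1 * cos (w * t) + \<alpha> s $ 2 * sin (w * t)))
      = w * (\<alpha> s \<bullet> T s)"
    using sin_cos_squared_add[of "w * t"] unfolding inner_vec_def sum_2 inner_real_def by algebra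
  then show ?thesis
    by (simp add: surface_normal_def frechet_derivative_twizzler_map cross3_def vec_eq_iff forall_3)
qed

lemma norm_surface_normal_twizzler_map:
  assumes unit: "norm (T s) = 1"
  shows "norm (surface_normal (twizzler_map w \<alpha>) (s, t)) = sqrt (1 + w\<^sup>2 * (\<alpha> s \<bullet> T s)\<^sup>2)"
proof -
  have "(T s $ 1 * sin (w * t) - T s $ 2 * cos (w * t))\<^sup>2 + (T s $ 1 * cos (w * t) + T s $ 2 * sin (w * t))\<^sup>2 = 1"
  proof -
    have "(T s $ 1)\<^sup>2 + (T s $ 2)\<^sup>2 = 1"
      using unit by (simp add: norm_vec_def L2_set_def sum_2)
    then show ?thesis using sin_cos_squared_add[of "w * t"] by algebra
  qed
  then show ?thesis
    by (simp add: surface_normal_twizzler_map norm_vec_def L2_set_def sum_3 power_mult_distrib algebra_simps)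
qed

text \<open>
The partial derivative of the Twizzler in its first variable, at parameter \<open>(s, 0)\<close>, is the tangent
of the profile curve; so smoothness of the surface passes to the curve.
\<close>

lemma tangent_differentiable_if_twizzler_smooth:
  assumes "smooth (twizzler_map w \<alpha>)"
  shows "T differentiable (at s)"
proof -
  let ?d = "\<lambda>p. frechet_derivative (twizzler_map w \<alpha>) (at p) (1, 0)"
  define L where "L v = (vector [v $ 1, v $ 3] :: real^2)" for v :: "real^3"
  have "cont_diff (Suc (Suc 0)) (twizzler_map w \<alpha>)"
    using assms unfolding smooth_def by blast
  then have "?d differentiable (at (s, 0))"
    by (auto simp: differentiable_on_def)
  then have "(?d \<circ> (\<lambda>s. (s, 0))) differentiable (at s)"
    by (intro differentiable_chain_at) (auto intro!: derivative_intros simp: differentiable_def)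
  moreover have "linear L"
    by (rule linearI) (simp_all add: L_def vec_eq_iff forall_2)
  ultimately have "(L \<circ> (?d \<circ> (\<lambda>s. (s, 0)))) differentiable (at s)"
    by (intro differentiable_chain_at[where g=L] linear_imp_differentiable[of L])
  moreover have "L \<circ> (?d \<circ> (\<lambda>s. (s, 0))) = T"
    by (auto simp: L_def frechet_derivative_twizzler_map vec_eq_iff forall_2)
  ultimately show ?thesis by simp
qed

text \<open>
The surface is invariant under a helicoidal group, so its curvature at \<open>t = 0\<close> says everything; the
variable \<open>t\<close> is needed only to differentiate the Gauss map there. In an equation
\<open>d\<nu> v = - k d\<phi> v\<close> the normal component is discarded by pairing with tangent vectors, and with it the
derivative of the normalizing factor \<open>1 / W\<close>. What remains are the fundamental forms
\<open>E = 1\<close>, \<open>F = w q\<close>, \<open>G = 1 + w\<^sup>2 |\<alpha>|\<^sup>2\<close> and, up to the factor \<open>1 / W\<close>, \<open>e = \<kappa>\<close>, \<open>f = - w\<close>, \<open>g = - w\<^sup>2 q\<close>,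
with \<open>E G - F\<^sup>2 = W\<^sup>2\<close>.
\<close>

lemma twizzler_curvature_equation:
  assumes unit: "\<And>s. norm (T s) = 1"
    and T: "(T has_vector_derivative T') (at s)"
    and H: "has_mean_curvature (twizzler_map w \<alpha>) (s, 0) H"
  shows "cross2 (T s) T' * (1 + w\<^sup>2 * ((\<alpha> s \<bullet> T s)\<^sup>2 + (cross2 (T s) (\<alpha> s))\<^sup>2)) + w\<^sup>2 * cross2 (T s) (\<alpha> s)
      = 2 * H * sqrt (1 + w\<^sup>2 * (\<alpha> s \<bullet> T s)\<^sup>2) ^ 3"
proof -
  define x z x' z' x'' z'' where "x = \<alpha> s $ 1" and "z = \<alpha> s $ 2" and "x' = T s $ 1" and "z' = T s $ 2"
    and "x'' = T' $ 1" and "z'' = T' $ 2"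
  note defs = x_def z_def x'_def z'_def x''_def z''_def
  define \<kappa> where "\<kappa> = cross2 (T s) T'"
  define p where "p s = \<alpha> s \<bullet> T s" for s
  define q where "q = cross2 (T s) (\<alpha> s)"
  define W where "W s = sqrt (1 + w\<^sup>2 * (p s)\<^sup>2)" for s
  have W: "0 < W s" "(W s)\<^sup>2 = 1 + w\<^sup>2 * (p s)\<^sup>2" for s
    by (auto simp: W_def add_pos_nonneg)
  have p_eq: "p s = x * x' + z * z'"
    by (simp add: p_def defs inner_vec_def sum_2)
  have q_eq: "q = z * x' - x * z'"
    by (simp add: q_def cross2_def defs algebra_simps)
  have unit': "x'\<^sup>2 + z'\<^sup>2 = 1"
    using unit[of s] by (simp add: defs norm_vec_def L2_set_def sum_2)
  have T1: "((\<lambda>s. T s $ 1) has_real_derivative x'') (at s)" and T2: "((\<lambda>s. T s $ 2) has_real_derivative z'') (at s)"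
    using has_real_derivative_component[OF T] by (auto simp: defs)
  note frame = frame_equations[OF \<alpha> unit T]
  have x'': "x'' = - \<kappa> * z'" and z'': "z'' = \<kappa> * x'"
    using frame(1,2) by (simp_all add: \<kappa>_def defs)
  have p': "(p has_real_derivative 1 + \<kappa> * q) (at s)"
    using frame(3) unfolding p_def[abs_def] \<kappa>_def q_def .
  define n where "n = surface_normal (twizzler_map w \<alpha>)"
  define dn where "dn v = (vector
      [- (z'' * fst v) + w * x' * snd v, w * (1 + \<kappa> * q) * fst v, x'' * fst v + w * z' * snd v] :: real^3)" for v
  have n0: "n (s, 0) = vector [- z', w * p s, x']"
    by (simp add: n_def surface_normal_twizzler_map p_def defs)
  have dn: "(n has_derivative dn) (at (s, 0))"
  proof -
    have n: "n = (\<lambda>r. vector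
      [T (fst r) $ 1 * sin (w * snd r) - T (fst r) $ 2 * cos (w * snd r), w * p (fst r),
       T (fst r) $ 1 * cos (w * snd r) + T (fst r) $ 2 * sin (w * snd r)])"
      by (auto simp: n_def p_def surface_normal_twizzler_map)
    show ?thesis
      unfolding n dn_def
      by (auto intro!: derivative_eq_intros has_derivative_vector_3 has_derivative_fst_coordinate[OF p']
          has_derivative_fst_coordinate[of "\<lambda>s. T s $ 1", OF T1] has_derivative_fst_coordinate[of "\<lambda>s. T s $ 2", OF T2]
          simp: defs)
  qed
  have "((\<lambda>s. 1 + w\<^sup>2 * (p s)\<^sup>2) has_real_derivative w\<^sup>2 * (2 * p s * (1 + \<kappa> * q))) (at s)"
    by (auto intro!: derivative_eq_intros p')
  from DERIV_chain2[OF DERIV_real_sqrt this] have "\<exists>W'. (W has_real_derivative W') (at s)"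
    unfolding W_def[abs_def] by (auto simp: add_pos_nonneg)
  then obtain W' where "(W has_real_derivative W') (at s)" by blast
  from DERIV_inverse'[OF this] W(1)[of s] obtain m where m: "((\<lambda>s. inverse (W s)) has_real_derivative m) (at s)" by auto
  have gauss: "gauss_map (twizzler_map w \<alpha>) = (\<lambda>r. inverse (W (fst r)) *\<^sub>R n r)"
    by (auto simp: gauss_map_def n_def W_def p_def norm_surface_normal_twizzler_map unit)
  have "(gauss_map (twizzler_map w \<alpha>) has_derivative
      (\<lambda>v. inverse (W s) *\<^sub>R dn v + (m * fst v) *\<^sub>R n (s, 0))) (at (s, 0))"
    using has_derivative_scaleR[OF has_derivative_fst_coordinate[OF m] dn] by (simp add: gauss)
  from frechet_derivative_at[OF this, symmetric] have d\<nu>: "frechet_derivative (gauss_map (twizzler_map w \<alpha>)) (at (s, 0)) v =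
      inverse (W s) *\<^sub>R dn v + (m * fst v) *\<^sub>R n (s, 0)" for v
    by (simp only:)
  define d\<phi> where "d\<phi> = frechet_derivative (twizzler_map w \<alpha>) (at (s, 0))"
  have d\<phi>: "d\<phi> v = vector [fst v * x' + snd v * (w * z), snd v, fst v * z' - snd v * (w * x)]" for v
    by (simp add: d\<phi>_def frechet_derivative_twizzler_map defs)
  have shape:
    "\<kappa> * fst v + (- w) * snd v = (k * W s) * (1 * fst v + (w * q) * snd v)"
    "(- w) * fst v + (- (w\<^sup>2 * q)) * snd v = (k * W s) * ((w * q) * fst v + (1 + w\<^sup>2 * (x\<^sup>2 + z\<^sup>2)) * snd v)"
    if "principal_direction (twizzler_map w \<alpha>) (s, 0) k v" for k v
  proof -
    have eq: "inverse (W s) *\<^sub>R dn v + (m * fst v) *\<^sub>R n (s, 0) = - k *\<^sub>R d\<phi> v"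
      using that by (simp add: principal_direction_def d\<nu> d\<phi>_def)
    have tangential: "dn v \<bullet> d\<phi> u = - (k * W s) * (d\<phi> v \<bullet> d\<phi> u)" for u
    proof -
      have "n (s, 0) \<bullet> d\<phi> u = 0"
        by (simp add: n0 d\<phi> inner_vec_def sum_3 p_eq algebra_simps)
      then have "inverse (W s) * (dn v \<bullet> d\<phi> u) = - k * (d\<phi> v \<bullet> d\<phi> u)"
        using arg_cong[OF eq, of "\<lambda>a. a \<bullet> d\<phi> u"] by (simp add: inner_add_left)
      then show ?thesis using W(1)[of s] by (simp add: field_simps)
    qed
    show "\<kappa> * fst v + (- w) * snd v = (k * W s) * (1 * fst v + (w * q) * snd v)"
      using tangential[of "(1, 0)"] unit'
      unfolding dn_def d\<phi> inner_vec_def sum_3 inner_real_def vector_3 fst_conv snd_conv x'' z'' q_eq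
      by algebra
    show "(- w) * fst v + (- (w\<^sup>2 * q)) * snd v = (k * W s) * ((w * q) * fst v + (1 + w\<^sup>2 * (x\<^sup>2 + z\<^sup>2)) * snd v)"
      using tangential[of "(0, 1)"] unit'
      unfolding dn_def d\<phi> inner_vec_def sum_3 inner_real_def vector_3 fst_conv snd_conv x'' z'' q_eq
      by algebra
  qed
  obtain k l v u where v: "principal_direction (twizzler_map w \<alpha>) (s, 0) k v"
    and u: "principal_direction (twizzler_map w \<alpha>) (s, 0) l u"
    and vu: "v \<noteq> u" "independent {v, u}" and kl: "H = (k + l) / 2"
    using H by (auto simp: has_mean_curvature_def principal_curvatures_def)
  have "\<kappa> * (1 + w\<^sup>2 * (x\<^sup>2 + z\<^sup>2)) - 2 * (- w) * (w * q) + (- (w\<^sup>2 * q)) * 1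
      = (k * W s + l * W s) * (1 * (1 + w\<^sup>2 * (x\<^sup>2 + z\<^sup>2)) - (w * q)\<^sup>2)"
    by (rule sum_of_eigenvalues_eq_mixed_discriminant[OF independent_pair_det_nonzero[OF vu] shape[OF v] shape[OF u]])
  moreover have "1 * (1 + w\<^sup>2 * (x\<^sup>2 + z\<^sup>2)) - (w * q)\<^sup>2 = (W s)\<^sup>2"
    using unit' unfolding W(2) p_eq q_eq by algebra
  moreover have "k + l = 2 * H" using kl by simp
  ultimately have "\<kappa> * (1 + w\<^sup>2 * (x\<^sup>2 + z\<^sup>2)) + w\<^sup>2 * q = 2 * H * (W s) ^ 3"
    by algebra
  moreover have "x\<^sup>2 + z\<^sup>2 = (p s)\<^sup>2 + q\<^sup>2"
    using unit' unfolding p_eq q_eq by algebra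
  ultimately show ?thesis by (simp add: \<kappa>_def W_def p_def q_def)
qed

end

section \<open>The cylinder of radius one half\<close>

lemma has_derivative_trigonometric_plus_affine:
  fixes l :: "'a::real_normed_vector \<Rightarrow> real" and A :: "'a \<Rightarrow> 'b::real_normed_vector"
  assumes "bounded_linear l" "bounded_linear A"
  shows "((\<lambda>p. cos (l p) *\<^sub>R a + sin (l p) *\<^sub>R b + A p + c) has_derivative
    (\<lambda>v. (l v * cos (l p)) *\<^sub>R b - (l v * sin (l p)) *\<^sub>R a + A v)) (at p)"
  by (auto intro!: derivative_eq_intros bounded_linear_imp_has_derivative assms simp: algebra_simps)

text \<open>
The family of all maps of this shape, for a fixed phase \<open>l\<close>, is closed under taking directional
derivatives, so differentiability of all orders follows by one induction over the whole family.
\<close>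

lemma cont_diff_trigonometric_plus_affine:
  fixes l :: "'a::euclidean_space \<Rightarrow> real" and A :: "'a \<Rightarrow> 'b::euclidean_space"
  assumes l: "bounded_linear l" and A: "bounded_linear A"
  shows "cont_diff k (\<lambda>p. cos (l p) *\<^sub>R a + sin (l p) *\<^sub>R b + A p + c)"
  using A
proof (induction k arbitrary: a b A c)
  case 0
  show ?case
    using has_derivative_continuous_on[OF has_derivative_at_withinI[OF
        has_derivative_trigonometric_plus_affine[OF l 0]]] by simp
next
  case (Suc k)
  note D = has_derivative_trigonometric_plus_affine[OF l Suc.prems]
  have "cont_diff k (\<lambda>p. frechet_derivative (\<lambda>p. cos (l p) *\<^sub>R a + sin (l p) *\<^sub>R b + A p + c) (at p) v)" for v
  proof -
    have "(\<lambda>p. frechet_derivative (\<lambda>p. cos (l p) *\<^sub>R a + sin (l p) *\<^sub>R b + A p + c) (at p) v)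
        = (\<lambda>p. cos (l p) *\<^sub>R (l v *\<^sub>R b) + sin (l p) *\<^sub>R (- l v *\<^sub>R a) + (\<lambda>_. 0) p + A v)"
      unfolding frechet_derivative_at[OF D, symmetric] by (simp add: algebra_simps)
    then show ?thesis using Suc.IH[OF bounded_linear_zero] by (simp only:)
  qed
  then show ?case
    by (auto simp: differentiable_on_def intro: differentiableI[OF D])
qed

definition half_radius_circle :: "real \<Rightarrow> real^2" where
  "half_radius_circle s = vector [cos (2 * s) / 2, sin (2 * s) / 2]"

lemma half_radius_circle_has_vector_derivative:
  "(half_radius_circle has_vector_derivative vector [- sin (2 * s), cos (2 * s)]) (at s)"
proof -
  have vec: "(vector [a, b] :: real^2) = a *\<^sub>R axis 1 1 + b *\<^sub>R axis 2 1" for a b :: real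
    by (simp add: vec_eq_iff forall_2 axis_def)
  show ?thesis
    unfolding half_radius_circle_def[abs_def] vec
    by (auto intro!: derivative_eq_intros simp: has_vector_derivative_def algebra_simps)
qed

lemma norm_half_radius_circle_tangent: "norm (vector [- sin (2 * s), cos (2 * s)] :: real^2) = 1"
  by (simp add: norm_vec_def L2_set_def sum_2)

lemma twizzler_map_half_radius_circle:
  "twizzler_map w half_radius_circle = (\<lambda>(s, t). vector [cos (2 * s - w * t) / 2, t, sin (2 * s - w * t) / 2])"
  by (auto simp: twizzler_map_def half_radius_circle_def cos_diff sin_diff
      add_divide_distrib diff_divide_distrib)

text \<open>
The helicoidal motion only rotates the circle within itself, so the surface is the cylinder over it,
with axis in the second coordinate direction.
\<close>

lemma circular_cylinder_half_radius_circle_twizzler: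
  "circular_cylinder (1 / 2) (range (twizzler_map w half_radius_circle))"
proof -
  have infdist: "infdist q (range (\<lambda>\<tau>. 0 + \<tau> *\<^sub>R axis 2 1)) = sqrt ((q $ 1)\<^sup>2 + (q $ 3)\<^sup>2)" for q :: "real^3"
  proof -
    have dist: "dist q (0 + \<tau> *\<^sub>R axis 2 1) = sqrt ((q $ 1)\<^sup>2 + (q $ 2 - \<tau>)\<^sup>2 + (q $ 3)\<^sup>2)" for \<tau> :: real
      by (simp add: dist_norm norm_vec_def L2_set_def sum_3 axis_def)
    show ?thesis
    proof (rule antisym)
      show "infdist q (range (\<lambda>\<tau>. 0 + \<tau> *\<^sub>R axis 2 1)) \<le> sqrt ((q $ 1)\<^sup>2 + (q $ 3)\<^sup>2)"
        using infdist_le[of "0 + q $ 2 *\<^sub>R axis 2 1" "range (\<lambda>\<tau>. 0 + \<tau> *\<^sub>R axis 2 1)" q] unfolding dist by auto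
      show "sqrt ((q $ 1)\<^sup>2 + (q $ 3)\<^sup>2) \<le> infdist q (range (\<lambda>\<tau>. 0 + \<tau> *\<^sub>R axis 2 1))"
        by (subst infdist_notempty) (auto intro!: cINF_greatest simp: dist[simplified])
    qed
  qed
  have "q \<in> range (twizzler_map w half_radius_circle) \<longleftrightarrow> sqrt ((q $ 1)\<^sup>2 + (q $ 3)\<^sup>2) = 1 / 2" for q
  proof
    assume "q \<in> range (twizzler_map w half_radius_circle)"
    then obtain s t where q: "q = vector [cos (2 * s - w * t) / 2, t, sin (2 * s - w * t) / 2]"
      by (auto simp: twizzler_map_half_radius_circle)
    show "sqrt ((q $ 1)\<^sup>2 + (q $ 3)\<^sup>2) = 1 / 2"
      unfolding q by (simp add: power_divide real_sqrt_divide flip: add_divide_distrib)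
  next
    assume "sqrt ((q $ 1)\<^sup>2 + (q $ 3)\<^sup>2) = 1 / 2"
    then have "(q $ 1)\<^sup>2 + (q $ 3)\<^sup>2 = (1 / 2)\<^sup>2"
      by (metis real_sqrt_pow2 sum_power2_ge_zero)
    then have "(2 * q $ 1)\<^sup>2 + (2 * q $ 3)\<^sup>2 = 1"
      by (simp add: power2_eq_square)
    then obtain \<beta> where "2 * q $ 1 = cos \<beta>" "2 * q $ 3 = sin \<beta>"
      using sincos_total_2pi by metis
    moreover have "2 * ((\<beta> + w * q $ 2) / 2) - w * q $ 2 = \<beta>" by (simp add: field_simps)
    ultimately have "q = twizzler_map w half_radius_circle ((\<beta> + w * q $ 2) / 2, q $ 2)"
      by (simp only: twizzler_map_half_radius_circle vec_eq_iff forall_3 split_conv vector_3) simp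
    then show "q \<in> range (twizzler_map w half_radius_circle)" by blast
  qed
  then have "range (twizzler_map w half_radius_circle) =
      {q. infdist q (range (\<lambda>\<tau>. 0 + \<tau> *\<^sub>R axis 2 1)) = 1 / 2}"
    unfolding infdist by blast
  moreover have "axis 2 1 \<noteq> (0 :: real^3)" by simp
  ultimately show ?thesis
    unfolding circular_cylinder_def by blast
qed

text \<open>
The principal curvatures are \<open>2\<close> along the circles and \<open>0\<close> along the rulings; the rulings are the
curves on which the phase \<open>2 s - w t\<close> is constant. The circle is run through counterclockwise, which
makes the Gauss map point inwards.
\<close>

lemma cmc_twizzler_half_radius_circle: "cmc_twizzler w 1 half_radius_circle"
proof -
  define \<phi> where "\<phi> = twizzler_map w half_radius_circle"
  define l where "l p = 2 * fst p - w * snd p" for p :: "real \<times> real"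
  have l: "bounded_linear l"
    unfolding l_def by (intro bounded_linear_intros bounded_linear_const_mult)
  have \<phi>: "\<phi> = (\<lambda>p. cos (l p) *\<^sub>R (axis 1 (1 / 2)) + sin (l p) *\<^sub>R (axis 3 (1 / 2)) + snd p *\<^sub>R axis 2 1 + 0)"
    by (auto simp: \<phi>_def twizzler_map_half_radius_circle l_def vec_eq_iff forall_3 axis_def)
  have snd: "bounded_linear (\<lambda>p. snd p *\<^sub>R axis 2 1 :: real^3)"
    by (intro bounded_linear_intros)
  have "smooth \<phi>"
    unfolding smooth_def \<phi> by (intro allI cont_diff_trigonometric_plus_affine l snd)
  have d\<phi>: "frechet_derivative \<phi> (at p) v = vector [- (l v * sin (l p)) / 2, snd v, l v * cos (l p) / 2]" for p v
    unfolding \<phi> frechet_derivative_at[OF has_derivative_trigonometric_plus_affine[OF l snd], symmetric]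
    by (simp add: vec_eq_iff forall_3 axis_def)
  have normal: "surface_normal \<phi> p = vector [- cos (l p), 0, - sin (l p)]" for p
    by (simp add: surface_normal_def d\<phi> l_def cross3_def)
  have gauss: "gauss_map \<phi> = (\<lambda>p. cos (l p) *\<^sub>R axis 1 (- 1) + sin (l p) *\<^sub>R axis 3 (- 1) + 0 + 0)"
    by (auto simp: gauss_map_def normal norm_vec_def L2_set_def sum_3 vec_eq_iff forall_3 axis_def)
  have d\<nu>: "frechet_derivative (gauss_map \<phi>) (at p) v = vector [l v * sin (l p), 0, - (l v * cos (l p))]" for p v
    unfolding gauss frechet_derivative_at[OF has_derivative_trigonometric_plus_affine[OF l bounded_linear_zero], symmetric]
    by (simp add: vec_eq_iff forall_3 axis_def)
  have inj: "inj (frechet_derivative \<phi> (at p))" for p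
  proof (rule injI)
    fix u v assume eq: "frechet_derivative \<phi> (at p) u = frechet_derivative \<phi> (at p) v"
    then have snd: "snd u = snd v" and "l u * sin (l p) = l v * sin (l p)" "l u * cos (l p) = l v * cos (l p)"
      by (auto simp: d\<phi> vec_eq_iff forall_3)
    moreover have "l a = (l a * sin (l p)) * sin (l p) + (l a * cos (l p)) * cos (l p)" for a
      by (simp add: mult.assoc flip: distrib_left power2_eq_square)
    ultimately have "l u = l v" by metis
    with snd show "u = v" by (simp add: l_def prod_eq_iff)
  qed
  have "has_mean_curvature \<phi> p 1" for p
  proof -
    have "principal_direction \<phi> p 2 (1, 0)" "principal_direction \<phi> p 0 (w / 2, 1)"
      by (auto simp: principal_direction_def zero_prod_def d\<phi> d\<nu> l_def vec_eq_iff forall_3)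
    moreover have "independent {(1, 0), (w / 2, 1) :: real \<times> real}"
      by (auto simp: independent_insert span_singleton zero_prod_def)
    ultimately have "principal_curvatures \<phi> p 2 0"
      unfolding principal_curvatures_def by (intro exI[of _ "(1, 0)"] exI[of _ "(w / 2, 1)"]) auto
    then show ?thesis unfolding has_mean_curvature_def by force
  qed
  moreover have "arc_length_parametrized half_radius_circle"
    unfolding arc_length_parametrized_def
    using half_radius_circle_has_vector_derivative norm_half_radius_circle_tangent
    by (metis differentiableI_vector vector_derivative_at)
  ultimately show ?thesis
    using \<open>smooth \<phi>\<close> inj by (simp add: cmc_twizzler_def immersion_def \<phi>_def)
qed

lemma heart_fun_minimum_set: "{x. heart_fun w x = - 1 / 4} = {vector [0, - 1 / 2]}"
proof -
  have "heart_fun w x = - 1 / 4 \<longleftrightarrow> heart_coords w x = (0, 0)" for x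
    by (simp add: heart_fun_eq_norm_coords prod_eq_iff)
  moreover have "heart_coords w (vector [0, - 1 / 2]) = (0, 0)"
    by (simp add: heart_coords_def heart_scale_def)
  ultimately show ?thesis
    using injD[OF inj_heart_coords[of w]] by (metis (mono_tags, lifting) Collect_cong singleton_conv)
qed

section \<open>TreadmillSleds of Twizzlers\<close>

theorem theorem1p3:
  fixes w :: real
  assumes "w > 0"
  shows "(\<forall>\<alpha>. cmc_twizzler w 1 \<alpha> \<longrightarrow>
            (\<exists>M \<ge> - 1 / 4. range (treadmill_sled \<alpha>) = {- p | p. heart_fun w p = M}))
       \<and> (\<exists>\<alpha>. cmc_twizzler w 1 \<alpha> \<and>
            circular_cylinder (1 / 2) (range (twizzler_map w \<alpha>)) \<and>
            range (treadmill_sled \<alpha>) = {- p | p. heart_fun w p = - 1 / 4})"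
proof (intro conjI allI impI)
  fix \<alpha> :: "real \<Rightarrow> real^2"
  assume cmc: "cmc_twizzler w 1 \<alpha>"
  define T where "T s = vector_derivative \<alpha> (at s)" for s
  define T' where "T' s = vector_derivative T (at s)" for s
  have \<alpha>: "(\<alpha> has_vector_derivative T s) (at s)" and unit: "norm (T s) = 1" for s
    using cmc by (auto simp: cmc_twizzler_def arc_length_parametrized_def T_def vector_derivative_works)
  have "smooth (twizzler_map w \<alpha>)"
    using cmc by (simp add: cmc_twizzler_def immersion_def)
  then have T: "(T has_vector_derivative T' s) (at s)" for s
    using tangent_differentiable_if_twizzler_smooth[OF \<alpha>] by (simp add: T'_def flip: vector_derivative_works)
  have H: "has_mean_curvature (twizzler_map w \<alpha>) (s, 0) 1" for s
    using cmc by (simp add: cmc_twizzler_def)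
  have sled: "range (treadmill_sled \<alpha>) = uminus ` range (\<lambda>s. vector [\<alpha> s \<bullet> T s, cross2 (T s) (\<alpha> s)])"
    by (auto simp: treadmill_sled_eq[OF \<alpha> unit])
  have "\<exists>M \<ge> - 1 / 4. range (\<lambda>s. vector [\<alpha> s \<bullet> T s, cross2 (T s) (\<alpha> s)]) = {x. heart_fun w x = M}"
  proof (rule heart_flow_range[where \<kappa> = "\<lambda>s. cross2 (T s) (T' s)"])
    fix s
    show "((\<lambda>s. \<alpha> s \<bullet> T s) has_real_derivative 1 + cross2 (T s) (T' s) * cross2 (T s) (\<alpha> s)) (at s)"
      and "((\<lambda>s. cross2 (T s) (\<alpha> s)) has_real_derivative - (cross2 (T s) (T' s) * (\<alpha> s \<bullet> T s))) (at s)"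
      by (fact frame_equations[OF \<alpha> unit T])+
    show "cross2 (T s) (T' s) * (1 + w\<^sup>2 * ((\<alpha> s \<bullet> T s)\<^sup>2 + (cross2 (T s) (\<alpha> s))\<^sup>2)) + w\<^sup>2 * cross2 (T s) (\<alpha> s)
        = 2 * sqrt (1 + w\<^sup>2 * (\<alpha> s \<bullet> T s)\<^sup>2) ^ 3"
      using twizzler_curvature_equation[OF \<alpha> unit T H] by simp
  qed
  then obtain M where "M \<ge> - 1 / 4"
    "range (\<lambda>s. vector [\<alpha> s \<bullet> T s, cross2 (T s) (\<alpha> s)]) = {x. heart_fun w x = M}"
    by blast
  then show "\<exists>M \<ge> - 1 / 4. range (treadmill_sled \<alpha>) = {- p | p. heart_fun w p = M}"
    unfolding sled by auto
next
  have "treadmill_sled half_radius_circle s = - vector [0, - 1 / 2]" for s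
  proof -
    have "half_radius_circle s \<bullet> vector [- sin (2 * s), cos (2 * s)] = 0"
      by (simp add: half_radius_circle_def inner_vec_def sum_2)
    moreover have "cross2 (vector [- sin (2 * s), cos (2 * s)]) (half_radius_circle s) =
        - ((sin (2 * s))\<^sup>2 + (cos (2 * s))\<^sup>2) / 2"
      by (simp only: half_radius_circle_def cross2_def vector_2 power2_eq_square) (simp add: field_simps)
    ultimately show ?thesis
      using treadmill_sled_eq[OF half_radius_circle_has_vector_derivative norm_half_radius_circle_tangent, of s]
      by (simp only: sin_cos_squared_add)
  qed
  then have "range (treadmill_sled half_radius_circle) = uminus ` {x. heart_fun w x = - 1 / 4}"
    unfolding heart_fun_minimum_set by auto
  then have "range (treadmill_sled half_radius_circle) = {- p | p. heart_fun w p = - 1 / 4}"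
    by auto
  then show "\<exists>\<alpha>. cmc_twizzler w 1 \<alpha> \<and>
      circular_cylinder (1 / 2) (range (twizzler_map w \<alpha>)) \<and>
      range (treadmill_sled \<alpha>) = {- p | p. heart_fun w p = - 1 / 4}"
    using cmc_twizzler_half_radius_circle circular_cylinder_half_radius_circle_twizzler by blast
qed

end
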